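(* Let $X$ and $Y$ be finite $T_0$-spaces and let $f\colon X\to Y$ be a continuous map. Then the maps $\mathcal{U}(f)\colon\mathcal{U}(X)\to\mathcal{U}(Y)$ and $\mathcal{F}(f)\colon\mathcal{F}(X)\to\mathcal{F}(Y)$ are continuous. If, in addition, $\mathcal{U}(X)\cap\mathcal{F}(X)=\varnothing$, then the map $\mathcal{C}(f)\colon \mathcal{C}(X)\to \mathcal{C}(Y)$ is continuous.
   Context: A finite $T_0$-space is identified with a finite poset: $x\le y$ iff $U_x\subseteq U_y$, where $U_x=\{z\mid z\le x\}$ is the minimal open set containing $x$; $F_x=\{z\mid z\ge x\}$ is the smallest closed set containing $x$. Open sets are the down-sets, and continuous maps are the order-preserving maps. $\mathrm{mxl}(X)$ and $\mathrm{mnl}(X)$ are the sets of maximal and minimal elements of $X$. For a non-empty subset $A\subseteq X$ let $U_A=\bigcap_{a\in A}U_a$ and $F_A=\bigcap_{a\in A}F_a$. $\mathcal{U}(X)$ is the set of all connected components of the non-empty sets $U_A$ with $\varnothing\ne A\subseteq \mathrm{mxl}(X)$; $\mathcal{F}(X)$ is the set of all connected components of the non-empty sets $F_A$ with $\varnothing\neq A\subseteq\mathrm{mnl}(X)$. $\mathcal{U}(X)$ is the poset (finite $T_0$-space) ordered by $\subseteq$, and $\mathcal{F}(X)$ is the poset ordered by $\supseteq$ (that is, $C_1\le C_2$ iff $C_1\supseteq C_2$). $\mathcal{C}(X)$ is the poset with underlying set $\mathcal{U}(X)\cup\mathcal{F}(X)$ where $C_1\le C_2$ iff one of the following holds: $C_1,C_2\in\mathcal{U}(X)$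 and $C_1\subseteq C_2$; $C_1,C_2\in\mathcal{F}(X)$ and $C_1\supseteq C_2$; $C_1\in\mathcal{F}(X)$, $C_2\in\mathcal{U}(X)$ and $C_1\cap C_2\ne\varnothing$. For a continuous map $f\colon X\to Y$: $\mathcal{U}(f)(C)=\min\{D\in\mathcal{U}(Y)\mid f(C)\subseteq D\}$ for $C\in\mathcal{U}(X)$ (minimum in the poset $\mathcal{U}(Y)$), and $\mathcal{F}(f)(C)=\max\{D\in\mathcal{F}(Y)\mid f(C)\subseteq D\}$ for $C\in\mathcal{F}(X)$ (maximum in the poset $\mathcal{F}(Y)$, i.e. the smallest such $D$ for inclusion); these exist. If $\mathcal{U}(X)\cap\mathcal{F}(X)=\varnothing$, $\mathcal{C}(f)\colon\mathcal{C}(X)\to\mathcal{C}(Y)$ is the map equal to $\mathcal{U}(f)$ on $\mathcal{U}(X)$ and to $\mathcal{F}(f)$ on $\mathcal{F}(X)$. *)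

theory Defs
  imports "HOL-Analysis.Analysis"
begin

definition min_open :: "'a topology \<Rightarrow> 'a \<Rightarrow> 'a set"
  where "min_open X x = \<Inter>{V. openin X V \<and> x \<in> V}"

definition spec_le :: "'a topology \<Rightarrow> 'a \<Rightarrow> 'a \<Rightarrow> bool"
  where "spec_le X x y \<longleftrightarrow>
    x \<in> topspace X \<and> y \<in> topspace X \<and> min_open X x \<subseteq> min_open X y"

definition min_closed :: "'a topology \<Rightarrow> 'a \<Rightarrow> 'a set"
  where "min_closed X x = {z. spec_le X x z}"

text \<open>The finite space attached to a poset with carrier \<open>P\<close> and order \<open>le\<close>:
  the open sets are the down-sets.\<close>

definition downset_topology :: "'a set \<Rightarrow> ('a \<Rightarrow> 'a \<Rightarrow> bool) \<Rightarrow> 'a topology"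
  where "downset_topology P le =
    topology (\<lambda>V. V \<subseteq> P \<and> (\<forall>y\<in>V. \<forall>x\<in>P. le x y \<longrightarrow> x \<in> V))"

lemma openin_downset_topology:
  "openin (downset_topology P le) V \<longleftrightarrow> V \<subseteq> P \<and> (\<forall>y\<in>V. \<forall>x\<in>P. le x y \<longrightarrow> x \<in> V)"
proof -
  have "istopology (\<lambda>V. V \<subseteq> P \<and> (\<forall>y\<in>V. \<forall>x\<in>P. le x y \<longrightarrow> x \<in> V))"
    unfolding istopology_def by blast
  then show ?thesis
    by (simp add: downset_topology_def topology_inverse')
qed

lemma topspace_downset_topology [simp]: "topspace (downset_topology P le) = P"
  unfolding topspace_def openin_downset_topology by blast

text \<open>For finite spaces the descriptions of minimal open and closed sets agree with the
  usual ones, and the space is recovered from its order.\<close>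

lemma openin_min_open:
  assumes "finite (topspace X)" "x \<in> topspace X"
  shows "openin X (min_open X x)"
proof -
  have "finite {V. openin X V \<and> x \<in> V}"
    by (rule finite_subset[of _ "Pow (topspace X)"]) (use assms openin_subset in auto)
  then show ?thesis
    unfolding min_open_def using assms by (intro openin_Inter) auto
qed

lemma min_open_eq:
  assumes "finite (topspace X)" "x \<in> topspace X"
  shows "min_open X x = {z. spec_le X z x}"
proof -
  have "min_open X z \<subseteq> min_open X x" if "z \<in> min_open X x" for z
    using that openin_min_open[OF assms] by (auto simp: min_open_def)
  moreover have "min_open X x \<subseteq> topspace X"
    using openin_min_open[OF assms] openin_subset by blast
  moreover have "z \<in> min_open X z" for z
    by (auto simp: min_open_def)
  ultimately show ?thesis
    using assms by (auto simp: spec_le_def)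
qed

lemma min_closed_eq_closure_of:
  assumes "finite (topspace X)" "x \<in> topspace X"
  shows "min_closed X x = X closure_of {x}"
proof (intro set_eqI)
  fix z
  show "z \<in> min_closed X x \<longleftrightarrow> z \<in> X closure_of {x}"
  proof (cases "z \<in> topspace X")
    case True
    then have "spec_le X x z \<longleftrightarrow> x \<in> min_open X z"
      using min_open_eq[OF assms(1), of z] by auto
    then show ?thesis
      using True by (auto simp: min_closed_def in_closure_of min_open_def)
  next
    case False
    then show ?thesis
      by (auto simp: min_closed_def spec_le_def in_closure_of)
  qed
qed

lemma downset_topology_spec_le:
  assumes "finite (topspace X)"
  shows "downset_topology (topspace X) (spec_le X) = X"
proof (rule topology_eq[THEN iffD2], intro allI)
  fix V
  show "openin (downset_topology (topspace X) (spec_le X)) V \<longleftrightarrow> openin X V"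
  proof
    assume V: "openin (downset_topology (topspace X) (spec_le X)) V"
    have "\<exists>T. openin X T \<and> y \<in> T \<and> T \<subseteq> V" if "y \<in> V" for y
    proof (intro exI conjI)
      have y: "y \<in> topspace X"
        using V that by (auto simp: openin_downset_topology)
      show "openin X (min_open X y)"
        by (rule openin_min_open[OF assms y])
      show "y \<in> min_open X y"
        by (auto simp: min_open_def)
      show "min_open X y \<subseteq> V"
        using V that unfolding min_open_eq[OF assms y]
        by (auto simp: openin_downset_topology spec_le_def)
    qed
    then show "openin X V"
      by (subst openin_subopen) blast
  next
    assume V: "openin X V"
    have "x \<in> V" if "y \<in> V" "spec_le X x y" for x y
    proof -
      have "x \<in> min_open X x" 
        by (auto simp: min_open_def)
      then show ?thesis
        using that V by (auto simp: spec_le_def min_open_def)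
    qed
    then show "openin (downset_topology (topspace X) (spec_le X)) V"
      using openin_subset[OF V] by (auto simp: openin_downset_topology)
  qed
qed

definition mxl :: "'a topology \<Rightarrow> 'a set"
  where "mxl X = {x \<in> topspace X. \<forall>y. spec_le X x y \<longrightarrow> y = x}"

definition mnl :: "'a topology \<Rightarrow> 'a set"
  where "mnl X = {x \<in> topspace X. \<forall>y. spec_le X y x \<longrightarrow> y = x}"

definition U_inter :: "'a topology \<Rightarrow> 'a set \<Rightarrow> 'a set"
  where "U_inter X A = (\<Inter>a\<in>A. min_open X a)"

definition F_inter :: "'a topology \<Rightarrow> 'a set \<Rightarrow> 'a set"
  where "F_inter X A = (\<Inter>a\<in>A. min_closed X a)"

definition U_sets :: "'a topology \<Rightarrow> 'a set set"
  where "U_sets X = (\<Union>A \<in> {A. A \<noteq> {} \<and> A \<subseteq> mxl X \<and> U_inter X A \<noteq> {}}.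
    connected_components_of (subtopology X (U_inter X A)))"

definition F_sets :: "'a topology \<Rightarrow> 'a set set"
  where "F_sets X = (\<Union>A \<in> {A. A \<noteq> {} \<and> A \<subseteq> mnl X \<and> F_inter X A \<noteq> {}}.
    connected_components_of (subtopology X (F_inter X A)))"

definition C_le :: "'a topology \<Rightarrow> 'a set \<Rightarrow> 'a set \<Rightarrow> bool"
  where "C_le X C D \<longleftrightarrow>
    (C \<in> U_sets X \<and> D \<in> U_sets X \<and> C \<subseteq> D) \<or>
    (C \<in> F_sets X \<and> D \<in> F_sets X \<and> C \<supseteq> D) \<or>
    (C \<in> F_sets X \<and> D \<in> U_sets X \<and> C \<inter> D \<noteq> {})"

definition U_space :: "'a topology \<Rightarrow> 'a set topology"
  where "U_space X = downset_topology (U_sets X) (\<lambda>C D. C \<subseteq> D)"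

definition F_space :: "'a topology \<Rightarrow> 'a set topology"
  where "F_space X = downset_topology (F_sets X) (\<lambda>C D. C \<supseteq> D)"

definition C_space :: "'a topology \<Rightarrow> 'a set topology"
  where "C_space X = downset_topology (U_sets X \<union> F_sets X) (C_le X)"

text \<open>\<open>LEAST\<close> on sets refers to inclusion. As \<open>\<F>(Y)\<close> is ordered by reverse inclusion,
  its inclusion-least element is the maximum in that poset.\<close>

definition U_map :: "'b topology \<Rightarrow> ('a \<Rightarrow> 'b) \<Rightarrow> 'a set \<Rightarrow> 'b set"
  where "U_map Y f C = (LEAST D. D \<in> U_sets Y \<and> f ` C \<subseteq> D)"

definition F_map :: "'b topology \<Rightarrow> ('a \<Rightarrow> 'b) \<Rightarrow> 'a set \<Rightarrow> 'b set"
  where "F_map Y f C = (LEAST D. D \<in> F_sets Y \<and> f ` C \<subseteq> D)"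

text \<open>Only meaningful when \<open>U_sets X\<close> and \<open>F_sets X\<close> are disjoint.\<close>

definition C_map :: "'a topology \<Rightarrow> 'b topology \<Rightarrow> ('a \<Rightarrow> 'b) \<Rightarrow> 'a set \<Rightarrow> 'b set"
  where "C_map X Y f C = (if C \<in> U_sets X then U_map Y f C else F_map Y f C)"

end

theory Submission
  imports Defs
begin

text \<open>
  The families \<open>\<U>(Y)\<close> and \<open>\<F>(Y)\<close> arise in the same way: given sets \<open>N b\<close> indexed by
  \<open>b \<in> M\<close>, take the connected components of the non-empty intersections of the \<open>N b\<close>. A non-empty
  connected set \<open>S\<close> contained in at least one \<open>N b\<close> always lies in a least such component
  (lemma \<open>least_inter_component\<close>): intersect \<^emph>\<open>all\<close> the \<open>N b\<close> that contain \<open>S\<close>, and take the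
  component around \<open>S\<close>. Any other member \<open>D\<close> of the family containing \<open>S\<close> comes from an
  intersection of fewer sets, so it absorbs this component.

  The image \<open>f ` C\<close> of a member \<open>C\<close> of \<open>\<U>(X)\<close> is such a set \<open>S\<close>: \<open>C\<close> has an upper bound \<open>a\<close>, so
  \<open>f ` C\<close> is bounded by \<open>f a\<close>, and \<open>f a\<close> is below some maximal point of the finite \<open>T\<^sub>0\<close>-space \<open>Y\<close>.
  Dually for \<open>\<F>(X)\<close>. Hence \<open>\<U>(f)(C)\<close> and \<open>\<F>(f)(C)\<close> are the least members of their families that
  contain \<open>f ` C\<close>. Continuity is order preservation, and everything follows from this
  description: a larger \<open>C\<close> has a larger image and hence a larger least member around it, while if
  \<open>C \<in> \<F>(X)\<close> and \<open>D \<in> \<U>(X)\<close> share a point \<open>x\<close>, then \<open>f x\<close> lies in both \<open>\<F>(f)(C)\<close> and \<open>\<U>(f)(D)\<close>.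
\<close>

lemma spec_le_iff_mem_min_open:
  "spec_le X x y \<longleftrightarrow> x \<in> topspace X \<and> y \<in> topspace X \<and> x \<in> min_open X y"
  unfolding spec_le_def min_open_def by blast

lemma spec_le_refl: "x \<in> topspace X \<Longrightarrow> spec_le X x x"
  by (auto simp: spec_le_def)

lemma spec_le_trans: "spec_le X x y \<Longrightarrow> spec_le X y z \<Longrightarrow> spec_le X x z"
  by (auto simp: spec_le_def)

lemma spec_le_antisym:
  assumes "t0_space X" "spec_le X x y" "spec_le X y x"
  shows "x = y"
proof (rule ccontr)
  assume "x \<noteq> y"
  moreover have "x \<in> topspace X" "y \<in> topspace X" "x \<in> min_open X y" "y \<in> min_open X x"
    using assms(2,3) by (simp_all add: spec_le_iff_mem_min_open)
  ultimately obtain V where "openin X V" "x \<in> V \<longleftrightarrow> y \<notin> V"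
    using assms(1) unfolding t0_space_def by metis
  then show False
    using \<open>x \<in> min_open X y\<close> \<open>y \<in> min_open X x\<close> by (auto simp: min_open_def)
qed

lemma continuous_map_spec_le:
  assumes "continuous_map X Y f" "spec_le X x y"
  shows "spec_le Y (f x) (f y)"
proof -
  have xy: "x \<in> topspace X" "y \<in> topspace X" "x \<in> min_open X y"
    using assms(2) by (auto simp: spec_le_iff_mem_min_open)
  have "f x \<in> V" if "openin Y V" "f y \<in> V" for V
    using openin_continuous_map_preimage[OF assms(1) that(1)] xy that(2)
    by (auto simp: min_open_def)
  then show ?thesis
    using xy continuous_map_image_subset_topspace[OF assms(1)]
    by (auto simp: spec_le_iff_mem_min_open min_open_def)
qed

text \<open>In a finite space the sets \<open>min_open X b\<close> with \<open>b\<close> above \<open>x\<close> have an inclusion-maximal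
  member; the \<open>T\<^sub>0\<close> axiom turns the maximality of this set into maximality of the point.\<close>

lemma ex_mxl_above:
  assumes "finite (topspace X)" "t0_space X" "x \<in> topspace X"
  obtains b where "b \<in> mxl X" "spec_le X x b"
proof -
  let ?A = "min_open X ` {b. spec_le X x b}"
  have "{b. spec_le X x b} \<subseteq> topspace X"
    by (auto simp: spec_le_def)
  then have fin: "finite ?A"
    using assms(1) finite_subset by blast
  have ne: "?A \<noteq> {}"
    using spec_le_refl[OF assms(3)] by blast
  obtain m where m: "m \<in> ?A" "\<forall>c\<in>?A. m \<le> c \<longrightarrow> m = c"
    using finite_has_maximal[OF fin ne] by (elim bexE) (rule that)
  from m(1) obtain b where b: "spec_le X x b" "m = min_open X b"
    by blast
  have "y = b" if y: "spec_le X b y" for y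
  proof -
    have "min_open X y \<in> ?A"
      using spec_le_trans[OF b(1) y] by blast
    then have "min_open X b = min_open X y"
      using m(2) y unfolding b(2) spec_le_def by blast
    then show ?thesis
      using y by (intro spec_le_antisym[OF assms(2)]) (simp_all add: spec_le_def)
  qed
  then have "b \<in> mxl X"
    using b(1) by (auto simp: mxl_def spec_le_iff_mem_min_open)
  then show ?thesis
    using b(1) that by blast
qed

lemma ex_mnl_below:
  assumes "finite (topspace X)" "t0_space X" "x \<in> topspace X"
  obtains b where "b \<in> mnl X" "spec_le X b x"
proof -
  let ?A = "min_open X ` {b. spec_le X b x}"
  have "{b. spec_le X b x} \<subseteq> topspace X"
    by (auto simp: spec_le_def)
  then have fin: "finite ?A"
    using assms(1) finite_subset by blast
  have ne: "?A \<noteq> {}"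
    using spec_le_refl[OF assms(3)] by blast
  obtain m where m: "m \<in> ?A" "\<forall>c\<in>?A. c \<le> m \<longrightarrow> m = c"
    using finite_has_minimal[OF fin ne] by (elim bexE) (rule that)
  from m(1) obtain b where b: "spec_le X b x" "m = min_open X b"
    by blast
  have "y = b" if y: "spec_le X y b" for y
  proof -
    have "min_open X y \<in> ?A"
      using spec_le_trans[OF y b(1)] by blast
    then have "min_open X b = min_open X y"
      using m(2) y unfolding b(2) spec_le_def by blast
    then show ?thesis
      using y by (intro spec_le_antisym[OF assms(2)]) (simp_all add: spec_le_def)
  qed
  then have "b \<in> mnl X"
    using b(1) by (auto simp: mnl_def spec_le_iff_mem_min_open)
  then show ?thesis
    using b(1) that by blast
qed

text \<open>The common pattern of \<open>U_sets\<close> and \<open>F_sets\<close>, so that the two dual arguments are made once.\<close>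

definition inter_components :: "'a topology \<Rightarrow> ('i \<Rightarrow> 'a set) \<Rightarrow> 'i set \<Rightarrow> 'a set set"
  where "inter_components X N M = (\<Union>A \<in> {A. A \<noteq> {} \<and> A \<subseteq> M \<and> (\<Inter>a\<in>A. N a) \<noteq> {}}.
    connected_components_of (subtopology X (\<Inter>a\<in>A. N a)))"

lemma U_sets_eq: "U_sets X = inter_components X (min_open X) (mxl X)"
  by (simp add: U_sets_def inter_components_def U_inter_def)

lemma F_sets_eq: "F_sets X = inter_components X (min_closed X) (mnl X)"
  by (simp add: F_sets_def inter_components_def F_inter_def)

lemma inter_componentsE:
  assumes "C \<in> inter_components X N M"
  obtains A where "A \<noteq> {}" "A \<subseteq> M" "C \<in> connected_components_of (subtopology X (\<Inter>a\<in>A. N a))"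
    "C \<noteq> {}" "connectedin X C" "\<And>a. a \<in> A \<Longrightarrow> C \<subseteq> N a"
proof -
  obtain A where A: "A \<noteq> {}" "A \<subseteq> M"
    and C: "C \<in> connected_components_of (subtopology X (\<Inter>a\<in>A. N a))"
    using assms by (auto simp: inter_components_def)
  have "connectedin (subtopology X (\<Inter>a\<in>A. N a)) C"
    using C by (rule connectedin_connected_components_of)
  then have "connectedin X C" "C \<subseteq> (\<Inter>a\<in>A. N a)"
    by (auto simp: connectedin_subtopology)
  moreover have "C \<noteq> {}"
    using C by (rule nonempty_connected_components_of)
  ultimately show ?thesis
    using that A C by blast
qed

text \<open>The least member is the component around \<open>S\<close> of the intersection of all \<open>N b\<close> that
  contain \<open>S\<close>: this is the smallest of the intersections that contain \<open>S\<close>, and a connected set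
  that meets a component of a larger intersection lies inside it.\<close>

lemma least_inter_component:
  assumes S: "connectedin X S" "S \<noteq> {}" and b: "b \<in> M" "S \<subseteq> N b"
  obtains D where "D \<in> inter_components X N M" "S \<subseteq> D"
    "\<And>D'. D' \<in> inter_components X N M \<Longrightarrow> S \<subseteq> D' \<Longrightarrow> D \<subseteq> D'"
proof -
  define B where "B = {b \<in> M. S \<subseteq> N b}"
  have B: "B \<noteq> {}" "B \<subseteq> M" "S \<subseteq> (\<Inter>b\<in>B. N b)"
    using b by (auto simp: B_def)
  have conS: "connectedin (subtopology X (\<Inter>b\<in>B. N b)) S"
    using S B by (simp add: connectedin_subtopology)
  then have "subtopology X (\<Inter>b\<in>B. N b) \<noteq> trivial_topology"
    using S(2) connectedin_subset_topspace by fastforce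
  then obtain D where D: "D \<in> connected_components_of (subtopology X (\<Inter>b\<in>B. N b))" "S \<subseteq> D"
    using exists_connected_component_of_superset[OF conS] by blast
  have "(\<Inter>b\<in>B. N b) \<noteq> {}"
    using B S by auto
  then have "D \<in> inter_components X N M"
    using B D by (auto simp: inter_components_def)
  moreover have "D \<subseteq> D'" if D': "D' \<in> inter_components X N M" "S \<subseteq> D'" for D'
  proof -
    obtain A where A: "A \<subseteq> M" "D' \<in> connected_components_of (subtopology X (\<Inter>a\<in>A. N a))"
      "\<And>a. a \<in> A \<Longrightarrow> D' \<subseteq> N a"
      using D'(1) by (elim inter_componentsE) blast
    have "A \<subseteq> B"
      using A D'(2) by (auto simp: B_def)
    moreover have "connectedin X D" "D \<subseteq> (\<Inter>b\<in>B. N b)"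
      using connectedin_connected_components_of[OF D(1)] by (auto simp: connectedin_subtopology)
    ultimately have "connectedin (subtopology X (\<Inter>a\<in>A. N a)) D"
      by (auto simp: connectedin_subtopology)
    moreover have "\<not> disjnt D' D"
      using D(2) D'(2) S(2) by (auto simp: disjnt_def)
    ultimately show "D \<subseteq> D'"
      using A(2) by (intro connected_components_of_maximal)
  qed
  ultimately show ?thesis
    using that D(2) by blast
qed

text \<open>The form in which the least member is used: \<open>LEAST\<close> really denotes it.\<close>

lemma Least_inter_component:
  fixes X N M S
  defines "L \<equiv> LEAST D. D \<in> inter_components X N M \<and> S \<subseteq> D"
  assumes "connectedin X S" "S \<noteq> {}" "b \<in> M" "S \<subseteq> N b"
  shows "L \<in> inter_components X N M" "S \<subseteq> L"
    "\<And>D. D \<in> inter_components X N M \<Longrightarrow> S \<subseteq> D \<Longrightarrow> L \<subseteq> D"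
proof -
  obtain D where D: "D \<in> inter_components X N M" "S \<subseteq> D"
    "\<And>D'. D' \<in> inter_components X N M \<Longrightarrow> S \<subseteq> D' \<Longrightarrow> D \<subseteq> D'"
    using least_inter_component[where N = N and b = b, OF assms(2-)] by blast
  then have "L = D"
    unfolding L_def by (intro Least_equality) auto
  with D show "L \<in> inter_components X N M" "S \<subseteq> L"
    "\<And>D. D \<in> inter_components X N M \<Longrightarrow> S \<subseteq> D \<Longrightarrow> L \<subseteq> D"
    by auto
qed

text \<open>A maximal point above \<open>f a\<close>, where \<open>a\<close> bounds \<open>C\<close> from above, bounds \<open>f ` C\<close>; so some
  member of \<open>U_sets Y\<close> contains \<open>f ` C\<close>.\<close>

lemma U_map_least:
  assumes Y: "finite (topspace Y)" "t0_space Y" and f: "continuous_map X Y f"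
    and C: "C \<in> U_sets X"
  shows "U_map Y f C \<in> U_sets Y" "f ` C \<subseteq> U_map Y f C"
    "\<And>D. D \<in> U_sets Y \<Longrightarrow> f ` C \<subseteq> D \<Longrightarrow> U_map Y f C \<subseteq> D"
proof -
  obtain a where a: "a \<in> mxl X" and sub: "C \<subseteq> min_open X a" and ne: "C \<noteq> {}"
    and con: "connectedin X C"
    using C unfolding U_sets_eq by (elim inter_componentsE) blast
  have aX: "a \<in> topspace X"
    using a by (simp add: mxl_def)
  then have "f a \<in> topspace Y"
    using continuous_map_image_subset_topspace[OF f] by blast
  then obtain b where b: "b \<in> mxl Y" "spec_le Y (f a) b"
    using ex_mxl_above[OF Y] by metis
  have "f c \<in> min_open Y b" if "c \<in> C" for c
  proof -
    have "spec_le X c a"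
      using that sub aX connectedin_subset_topspace[OF con] by (auto simp: spec_le_iff_mem_min_open)
    then have "spec_le Y (f c) b"
      using spec_le_trans[OF continuous_map_spec_le[OF f] b(2)] by blast
    then show ?thesis
      by (simp add: spec_le_iff_mem_min_open)
  qed
  then have "f ` C \<subseteq> min_open Y b"
    by blast
  note * = Least_inter_component[where N = "min_open Y" and b = b,
      OF connectedin_continuous_map_image[OF f con] _ b(1) this]
  show "U_map Y f C \<in> U_sets Y" "f ` C \<subseteq> U_map Y f C"
    "\<And>D. D \<in> U_sets Y \<Longrightarrow> f ` C \<subseteq> D \<Longrightarrow> U_map Y f C \<subseteq> D"
    using * ne unfolding U_map_def U_sets_eq by simp_all
qed

lemma F_map_least:
  assumes Y: "finite (topspace Y)" "t0_space Y" and f: "continuous_map X Y f"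
    and C: "C \<in> F_sets X"
  shows "F_map Y f C \<in> F_sets Y" "f ` C \<subseteq> F_map Y f C"
    "\<And>D. D \<in> F_sets Y \<Longrightarrow> f ` C \<subseteq> D \<Longrightarrow> F_map Y f C \<subseteq> D"
proof -
  obtain a where a: "a \<in> mnl X" and sub: "C \<subseteq> min_closed X a" and ne: "C \<noteq> {}"
    and con: "connectedin X C"
    using C unfolding F_sets_eq by (elim inter_componentsE) blast
  have "f a \<in> topspace Y"
    using a continuous_map_image_subset_topspace[OF f] by (auto simp: mnl_def)
  then obtain b where b: "b \<in> mnl Y" "spec_le Y b (f a)"
    using ex_mnl_below[OF Y] by metis
  have "f ` C \<subseteq> min_closed Y b"
    using sub spec_le_trans[OF b(2) continuous_map_spec_le[OF f]] by (auto simp: min_closed_def)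
  note * = Least_inter_component[where N = "min_closed Y" and b = b,
      OF connectedin_continuous_map_image[OF f con] _ b(1) this]
  show "F_map Y f C \<in> F_sets Y" "f ` C \<subseteq> F_map Y f C"
    "\<And>D. D \<in> F_sets Y \<Longrightarrow> f ` C \<subseteq> D \<Longrightarrow> F_map Y f C \<subseteq> D"
    using * ne unfolding F_map_def F_sets_eq by simp_all
qed

lemma continuous_map_downset_topology:
  assumes "\<And>x. x \<in> P \<Longrightarrow> g x \<in> Q"
    and "\<And>x y. x \<in> P \<Longrightarrow> y \<in> P \<Longrightarrow> le x y \<Longrightarrow> le' (g x) (g y)"
  shows "continuous_map (downset_topology P le) (downset_topology Q le') g"
  using assms unfolding continuous_map_def openin_downset_topology by auto

theorem proposition3p19:
  fixes X :: "'a topology" and Y :: "'b topology" and f :: "'a \<Rightarrow> 'b"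
  assumes "finite (topspace X)" and "t0_space X"
    and "finite (topspace Y)" and "t0_space Y"
    and "continuous_map X Y f"
  shows "continuous_map (U_space X) (U_space Y) (U_map Y f) \<and>
    continuous_map (F_space X) (F_space Y) (F_map Y f) \<and>
    (U_sets X \<inter> F_sets X = {} \<longrightarrow>
      continuous_map (C_space X) (C_space Y) (C_map X Y f))"
proof (intro conjI impI)
  note U = U_map_least[OF assms(3-5)] and F = F_map_least[OF assms(3-5)]
  have U_mono: "U_map Y f C \<subseteq> U_map Y f D" if "C \<in> U_sets X" "D \<in> U_sets X" "C \<subseteq> D" for C D
    by (rule U(3)[OF that(1) U(1)[OF that(2)]]) (use U(2)[OF that(2)] that(3) in blast)
  have F_mono: "F_map Y f C \<subseteq> F_map Y f D" if "C \<in> F_sets X" "D \<in> F_sets X" "C \<subseteq> D" for C D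
    by (rule F(3)[OF that(1) F(1)[OF that(2)]]) (use F(2)[OF that(2)] that(3) in blast)
  show "continuous_map (U_space X) (U_space Y) (U_map Y f)"
    unfolding U_space_def by (intro continuous_map_downset_topology U(1) U_mono)
  show "continuous_map (F_space X) (F_space Y) (F_map Y f)"
    unfolding F_space_def by (intro continuous_map_downset_topology F(1) F_mono)
  assume disj: "U_sets X \<inter> F_sets X = {}"
  have CU: "C_map X Y f C = U_map Y f C" if "C \<in> U_sets X" for C
    using that by (simp add: C_map_def)
  have CF: "C_map X Y f C = F_map Y f C" if "C \<in> F_sets X" for C
    using that disj by (auto simp: C_map_def)
  show "continuous_map (C_space X) (C_space Y) (C_map X Y f)"
    unfolding C_space_def
  proof (rule continuous_map_downset_topology)
    show "C_map X Y f C \<in> U_sets Y \<union> F_sets Y" if "C \<in> U_sets X \<union> F_sets X" for C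
      using that U(1) F(1) by (auto simp: CU CF)
    show "C_le Y (C_map X Y f C) (C_map X Y f D)" if "C_le X C D" for C D
      using that unfolding C_le_def[of X]
    proof (elim disjE conjE)
      assume "C \<in> U_sets X" "D \<in> U_sets X" "C \<subseteq> D"
      then show ?thesis
        using U(1) U_mono by (simp add: CU C_le_def)
    next
      assume "C \<in> F_sets X" "D \<in> F_sets X" "D \<subseteq> C"
      then show ?thesis
        using F(1) F_mono by (simp add: CF C_le_def)
    next
      assume C: "C \<in> F_sets X" and D: "D \<in> U_sets X" and "C \<inter> D \<noteq> {}"
      then have "F_map Y f C \<inter> U_map Y f D \<noteq> {}"
        using F(2)[OF C] U(2)[OF D] by blast
      then show ?thesis
        using C D F(1) U(1) by (simp add: CU CF C_le_def)
    qed
  qed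
qed

end
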